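(* Let $G=(V,E,\mathrm{lab})$ be an edge-labeled graph over a set of labels $L$. The algorithm GreedyAnd (defined in the context) runs in $O(p\log |L|+|V|+|E|)$ time, where $p=|\{(e,k) : e\in E,\ k\in \mathrm{lab}(e)\}|$ is the number of edge-label pairs.
   Context: An edge-labeled graph is a tuple $G=(V,E,\mathrm{lab})$, where $V$ is the set of vertices, $E$ is a set of undirected edges between distinct vertices, and $\mathrm{lab}:E\to 2^L$ maps each edge to its set of labels; $L$ is the set of all possible labels. For a label $\ell$, $E(\ell)$ is the set of edges having label $\ell$ and $V(\ell)$ is the set of vertices adjacent to $E(\ell)$. For $B\subseteq L$, the conjunctive-induced subgraph consists of the edges $e$ with $B\subseteq \mathrm{lab}(e)$ and the vertices adjacent to them; the density of a graph is its number of edges divided by its number of vertices. Algorithm GreedyAnd (greedy search for conjunctive-induced dense subgraphs): 1. Set $n_\ell\gets|V(\ell)|$ and $m_\ell\gets|E(\ell)|$ for each label $\ell\in L$, and $r_{v,\ell}\gets|\{e\in E(\ell): e \text{ is adjacent to } v\}|$ for each vertex $v$ and label $\ell$. Let $T$ be the labels sorted by the density values $m_\ell/n_\ell$ (e.g. in a red-black tree). Set $A_0\gets\emptyset$ and $i\gets0$. 2. While there are labels: pick and remove the label $k$ that has the maximum density in $T$; set $A_{i+1}\gets A_i\cup\{k\}$; for each edge $e=(u,v)$ without label $k$: for each label $\ell$ of $e$, decrease $m_\ell$, $r_{v,\ell}$ and $r_{u,\ell}$ by one, decrease $n_\ell$ by one if $r_{v,\ell}=0$, and decrease $n_\ell$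 by one if $r_{u,\ell}=0$; then remove the edge $e$. After this loop over edges, update $T$ for all labels $\ell$ with changed values of $m_\ell$ or $n_\ell$, and set $i\gets i+1$. 3. Return the set of labels $A_i$ that yields the highest density of the conjunctive-induced subgraph.
   Formalization: Labels of L that occur on no edge (density 0/0 undefined) are never entered into T or picked, since otherwise E empty, |V|=1 and |L| large would violate the bound; V is also assumed nonempty. *)

theory Defs
  imports Complex_Main "HOL-Library.RBT_Impl" "HOL-Library.Product_Lexorder"
    "HOL-Library.While_Combinator"
begin

section \<open>Edge-labeled graphs\<close>

text \<open>Undirected edges between distinct vertices are two-element sets of vertices. As usual, a
  graph has at least one vertex; its density would otherwise be undefined. Labels need not occur
  on any edge.\<close>

record ('v, 'l) lgraph =
  verts :: "'v set"
  edges :: "'v set set"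
  labels :: "'l set"
  lab :: "'v set \<Rightarrow> 'l set"

definition edge_labeled_graph :: "('v, 'l) lgraph \<Rightarrow> bool" where
  "edge_labeled_graph G \<longleftrightarrow>
     finite (verts G) \<and> verts G \<noteq> {} \<and> finite (labels G) \<and>
     (\<forall>e \<in> edges G. e \<subseteq> verts G \<and> card e = 2 \<and> lab G e \<subseteq> labels G)"

definition edge_label_pairs :: "('v, 'l) lgraph \<Rightarrow> ('v set \<times> 'l) set" where
  "edge_label_pairs G = {(e, k). e \<in> edges G \<and> k \<in> lab G e}"

text \<open>The machine input: a list of the vertices, and a list of the edges, each with its two
  ends and a list of its labels, all in arbitrary order.\<close>

record ('v, 'l) ledge =
  end1 :: 'v
  end2 :: 'v
  labs :: "'l list"

definition ends :: "('v, 'l) ledge \<Rightarrow> 'v set" where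
  "ends e = {end1 e, end2 e}"

definition represents ::
    "'v list \<Rightarrow> ('v, 'l) ledge list \<Rightarrow> ('v, 'l) lgraph \<Rightarrow> bool" where
  "represents vs es G \<longleftrightarrow>
     distinct vs \<and> set vs = verts G \<and>
     distinct (map ends es) \<and> ends ` set es = edges G \<and>
     (\<forall>e \<in> set es. distinct (labs e) \<and> set (labs e) = lab G (ends e))"


section \<open>Programs with running time\<close>

text \<open>A program maps a store to the resulting store and the number of elementary steps taken.
  The cost model is the unit-cost random access machine: vertices and labels are machine words
  that can be compared and used as array indices. \<open>step\<close> and \<open>test\<close> are charged one step and
  are only ever used for a bounded number of reads, writes, arithmetic operations and
  comparisons. Rational densities occur only as quotients of two counters, so that comparing
  two of them takes a constant number of integer operations.\<close>

type_synonym 's prog = "'s \<Rightarrow> 's \<times> nat"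
type_synonym 's guard = "'s \<Rightarrow> bool \<times> nat"

definition skip :: "'s prog" where
  "skip s = (s, 0)"

definition step :: "('s \<Rightarrow> 's) \<Rightarrow> 's prog" where
  "step f s = (f s, 1)"

definition seq :: "'s prog \<Rightarrow> 's prog \<Rightarrow> 's prog" (infixr \<open>;;\<close> 55) where
  "(p ;; q) s = (let (s1, t1) = p s; (s2, t2) = q s1 in (s2, t1 + t2))"

definition test :: "('s \<Rightarrow> bool) \<Rightarrow> 's guard" where
  "test b s = (b s, 1)"

definition cond :: "'s guard \<Rightarrow> 's prog \<Rightarrow> 's prog \<Rightarrow> 's prog" where
  "cond g p q s = (let (b, t) = g s; (s1, t1) = (if b then p s else q s) in (s1, t + t1))"

primrec for_each :: "'a list \<Rightarrow> ('a \<Rightarrow> 's prog) \<Rightarrow> 's prog" where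
  "for_each [] p s = (s, 1)"
| "for_each (x # xs) p s = (let (s1, t1) = p x s; (s2, t2) = for_each xs p s1 in (s2, 1 + t1 + t2))"

definition reading :: "('s \<Rightarrow> 'a) \<Rightarrow> ('a \<Rightarrow> 's prog) \<Rightarrow> 's prog" where
  "reading f p s = p (f s) s"

text \<open>The result is \<open>None\<close> iff the loop does not terminate. Every evaluation of the loop test
  costs one step.\<close>

definition loop_while :: "('s \<Rightarrow> bool) \<Rightarrow> 's prog \<Rightarrow> 's \<Rightarrow> ('s \<times> nat) option" where
  "loop_while b p s =
     while_option (\<lambda>(s, t). b s) (\<lambda>(s, t). let (s1, t1) = p s in (s1, t + t1 + 1)) (s, 1)"


section \<open>Running time of red-black trees\<close>

text \<open>The functions below count the calls of the corresponding recursive functions of the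
  library. Every function called besides these (rebalancing and recolouring) is not recursive
  and takes constant time.\<close>

fun T_lookup :: "('a::linorder, 'b) rbt \<Rightarrow> 'a \<Rightarrow> nat" where
  "T_lookup rbt.Empty k = 1"
| "T_lookup (rbt.Branch c l x y r) k =
     1 + (if k < x then T_lookup l k else if x < k then T_lookup r k else 0)"

fun T_ins :: "'a::linorder \<Rightarrow> ('a, 'b) rbt \<Rightarrow> nat" where
  "T_ins k rbt.Empty = 1"
| "T_ins k (rbt.Branch c l x y r) =
     1 + (if k < x then T_ins k l else if x < k then T_ins k r else 0)"

definition T_insert :: "'a::linorder \<Rightarrow> ('a, 'b) rbt \<Rightarrow> nat" where
  "T_insert k t = 1 + T_ins k t"

fun T_combine :: "('a, 'b) rbt \<Rightarrow> ('a, 'b) rbt \<Rightarrow> nat" where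
  "T_combine rbt.Empty x = 1"
| "T_combine x rbt.Empty = 1"
| "T_combine (rbt.Branch RBT_Impl.R a k x b) (rbt.Branch RBT_Impl.R c s y d) = 1 + T_combine b c"
| "T_combine (rbt.Branch RBT_Impl.B a k x b) (rbt.Branch RBT_Impl.B c s y d) = 1 + T_combine b c"
| "T_combine a (rbt.Branch RBT_Impl.R b k x c) = 1 + T_combine a b"
| "T_combine (rbt.Branch RBT_Impl.R a k x b) c = 1 + T_combine b c"

fun T_del :: "'a::linorder \<Rightarrow> ('a, 'b) rbt \<Rightarrow> nat" where
  "T_del k rbt.Empty = 1"
| "T_del k (rbt.Branch c l x y r) =
     1 + (if k < x then T_del k l else if x < k then T_del k r else T_combine l r)"

definition T_delete :: "'a::linorder \<Rightarrow> ('a, 'b) rbt \<Rightarrow> nat" where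
  "T_delete k t = 1 + T_del k t"

fun max_key :: "('a, 'b) rbt \<Rightarrow> 'a" where
  "max_key (rbt.Branch c l x y rbt.Empty) = x"
| "max_key (rbt.Branch c l x y (rbt.Branch c' l' x' y' r')) = max_key (rbt.Branch c' l' x' y' r')"

fun T_max_key :: "('a, 'b) rbt \<Rightarrow> nat" where
  "T_max_key rbt.Empty = 1"
| "T_max_key (rbt.Branch c l x y r) = 1 + T_max_key r"


section \<open>GreedyAnd\<close>

text \<open>The store. \<open>num_edges\<close>, \<open>num_verts\<close> and \<open>deg\<close> are the counters $m$, $n$ and $r$;
  \<open>queue\<close> is the tree $T$, in which a label \<open>l\<close> is filed under the key \<open>(dens l, l)\<close>, so that
  ties between densities are broken by the order of the labels and \<open>dens l\<close> is the density
  at the last update of the tree. \<open>live\<close> holds the edges not yet removed, each with a search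
  tree \<open>label_tree\<close> of its labels. \<open>chosen\<close> is $A_i$, as a list with the latest label first; the
  list is never modified in place, hence \<open>best := chosen\<close> takes constant time.
  Arrays are total functions; every entry is written before it is first read.\<close>

record ('v, 'l) store =
  num_edges :: "'l \<Rightarrow> nat"
  num_verts :: "'l \<Rightarrow> nat"
  deg :: "'v \<Rightarrow> 'l \<Rightarrow> nat"
  dens :: "'l \<Rightarrow> rat"
  queue :: "(rat \<times> 'l, unit) rbt"
  live :: "(('v, 'l) ledge \<times> ('l, unit) rbt) list"
  label_tree :: "('l, unit) rbt"
  current :: 'l
  pending :: "(('v, 'l) ledge \<times> ('l, unit) rbt) list"
  changed :: "'l list"
  chosen :: "'l list"
  best :: "'l list"
  best_dens :: rat
  stamp :: nat
  mark :: "'v \<Rightarrow> nat"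
  count_edges :: nat
  count_verts :: nat

definition empty_store :: "('v, 'l) store" where
  "empty_store = \<lparr>num_edges = undefined, num_verts = undefined, deg = undefined,
     dens = undefined, queue = rbt.Empty, live = [], label_tree = rbt.Empty,
     current = undefined, pending = [], changed = [], chosen = [], best = [], best_dens = 0,
     stamp = 0, mark = undefined, count_edges = 0, count_verts = 0\<rparr>"

text \<open>Division by zero yields zero: a label that has lost all its edges has density 0.\<close>

definition label_density :: "('v, 'l) store \<Rightarrow> 'l \<Rightarrow> rat" where
  "label_density s l = of_nat (num_edges s l) / of_nat (num_verts s l)"

definition queue_insert :: "'l::linorder \<Rightarrow> ('v, 'l) store prog" where
  "queue_insert l s = (let k = (dens s l, l) in
     (s\<lparr>queue := rbt_insert k () (queue s)\<rparr>, T_insert k (queue s)))"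

definition queue_delete :: "'l::linorder \<Rightarrow> ('v, 'l) store prog" where
  "queue_delete l s = (let k = (dens s l, l) in
     (s\<lparr>queue := rbt_delete k (queue s)\<rparr>, T_delete k (queue s)))"

definition in_queue :: "'l::linorder \<Rightarrow> ('v, 'l) store guard" where
  "in_queue l s = (let k = (dens s l, l) in
     (rbt_lookup (queue s) k \<noteq> None, T_lookup (queue s) k))"

definition queue_pop_max :: "('v, 'l::linorder) store prog" where
  "queue_pop_max s = (let k = max_key (queue s) in
     (s\<lparr>current := snd k, queue := rbt_delete k (queue s)\<rparr>,
      T_max_key (queue s) + T_delete k (queue s)))"

definition label_tree_insert :: "'l::linorder \<Rightarrow> ('v, 'l) store prog" where
  "label_tree_insert l s =
     (s\<lparr>label_tree := rbt_insert l () (label_tree s)\<rparr>, T_insert l (label_tree s))"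

definition has_current :: "('l::linorder, unit) rbt \<Rightarrow> ('v, 'l) store guard" where
  "has_current t s = (rbt_lookup t (current s) \<noteq> None, T_lookup t (current s))"

definition count_end :: "'v \<Rightarrow> 'l \<Rightarrow> ('v, 'l) store prog" where
  "count_end x l =
     cond (test (\<lambda>s. deg s x l = 0))
       (step (\<lambda>s. s\<lparr>num_verts := (num_verts s)(l := num_verts s l + 1)\<rparr>))
       skip ;;
     step (\<lambda>s. s\<lparr>deg := (deg s)(x := (deg s x)(l := deg s x l + 1))\<rparr>)"

definition uncount_end :: "'v \<Rightarrow> 'l \<Rightarrow> ('v, 'l) store prog" where
  "uncount_end x l =
     step (\<lambda>s. s\<lparr>deg := (deg s)(x := (deg s x)(l := deg s x l - 1))\<rparr>) ;;
     cond (test (\<lambda>s. deg s x l = 0))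
       (step (\<lambda>s. s\<lparr>num_verts := (num_verts s)(l := num_verts s l - 1)\<rparr>))
       skip"

text \<open>The labels are found by scanning the edges; filing a label again under its unchanged key leaves
  the contents of the tree as they are. A label that occurs on no edge has $n = m = 0$ and thus
  no density, and it does not enter the tree.\<close>

definition init :: "'v list \<Rightarrow> ('v, 'l::linorder) ledge list \<Rightarrow> ('v, 'l) store prog" where
  "init vs es =
     for_each vs (\<lambda>v. step (\<lambda>s. s\<lparr>mark := (mark s)(v := 0)\<rparr>)) ;;
     for_each es (\<lambda>e. for_each (labs e) (\<lambda>l.
       step (\<lambda>s. s\<lparr>num_edges := (num_edges s)(l := 0)\<rparr>) ;;
       step (\<lambda>s. s\<lparr>num_verts := (num_verts s)(l := 0)\<rparr>) ;;
       step (\<lambda>s. s\<lparr>deg := (deg s)(end1 e := (deg s (end1 e))(l := 0))\<rparr>) ;;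
       step (\<lambda>s. s\<lparr>deg := (deg s)(end2 e := (deg s (end2 e))(l := 0))\<rparr>))) ;;
     for_each es (\<lambda>e.
       step (\<lambda>s. s\<lparr>label_tree := rbt.Empty\<rparr>) ;;
       for_each (labs e) (\<lambda>l.
         step (\<lambda>s. s\<lparr>num_edges := (num_edges s)(l := num_edges s l + 1)\<rparr>) ;;
         count_end (end1 e) l ;;
         count_end (end2 e) l ;;
         label_tree_insert l) ;;
       step (\<lambda>s. s\<lparr>live := (e, label_tree s) # live s\<rparr>)) ;;
     for_each es (\<lambda>e. for_each (labs e) (\<lambda>l.
       step (\<lambda>s. s\<lparr>dens := (dens s)(l := label_density s l)\<rparr>) ;;
       queue_insert l))"

definition remove_edge :: "('v, 'l) ledge \<Rightarrow> ('v, 'l) store prog" where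
  "remove_edge e =
     for_each (labs e) (\<lambda>l.
       step (\<lambda>s. s\<lparr>num_edges := (num_edges s)(l := num_edges s l - 1)\<rparr>) ;;
       uncount_end (end1 e) l ;;
       uncount_end (end2 e) l ;;
       step (\<lambda>s. s\<lparr>changed := l # changed s\<rparr>))"

definition remove_edges_without_current :: "('v, 'l::linorder) store prog" where
  "remove_edges_without_current =
     step (\<lambda>s. s\<lparr>pending := live s, live := [], changed := []\<rparr>) ;;
     reading pending (\<lambda>xs. for_each xs (\<lambda>(e, t).
       cond (has_current t)
         (step (\<lambda>s. s\<lparr>live := (e, t) # live s\<rparr>))
         (remove_edge e)))"

text \<open>A label may occur repeatedly in \<open>changed\<close>. Labels that have already been picked are no
  longer in the tree and must not be put back.\<close>

definition update_queue :: "('v, 'l::linorder) store prog" where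
  "update_queue =
     reading changed (\<lambda>ls. for_each ls (\<lambda>l.
       cond (in_queue l)
         (queue_delete l ;;
          step (\<lambda>s. s\<lparr>dens := (dens s)(l := label_density s l)\<rparr>) ;;
          queue_insert l)
         skip))"

text \<open>The edges that are left are exactly those whose label set includes all chosen labels.
  They and their ends are counted, where \<open>mark v = stamp\<close> says that \<open>v\<close> has already been
  counted in this round.\<close>

definition visit :: "'v \<Rightarrow> ('v, 'l) store prog" where
  "visit v =
     cond (test (\<lambda>s. mark s v = stamp s))
       skip
       (step (\<lambda>s. s\<lparr>mark := (mark s)(v := stamp s), count_verts := count_verts s + 1\<rparr>))"

definition count_live :: "('v, 'l) store prog" where
  "count_live =
     step (\<lambda>s. s\<lparr>stamp := stamp s + 1, count_edges := 0, count_verts := 0\<rparr>) ;;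
     reading live (\<lambda>xs. for_each xs (\<lambda>(e, t).
       step (\<lambda>s. s\<lparr>count_edges := count_edges s + 1\<rparr>) ;;
       visit (end1 e) ;;
       visit (end2 e)))"

definition live_density :: "('v, 'l) store \<Rightarrow> rat" where
  "live_density s = of_nat (count_edges s) / of_nat (count_verts s)"

definition record_best :: "('v, 'l) store prog" where
  "record_best =
     step (\<lambda>s. s\<lparr>best := chosen s, best_dens := live_density s\<rparr>)"

definition greedy_round :: "('v, 'l::linorder) store prog" where
  "greedy_round =
     queue_pop_max ;;
     step (\<lambda>s. s\<lparr>chosen := current s # chosen s\<rparr>) ;;
     remove_edges_without_current ;;
     update_queue ;;
     count_live ;;
     cond (test (\<lambda>s. best_dens s < live_density s)) record_best skip"

text \<open>\<open>Some (A, t)\<close> means that the algorithm stops after \<open>t\<close> steps and returns the labels in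
  the list \<open>A\<close>; \<open>None\<close> means that it does not stop.\<close>

definition greedy_and ::
    "'v list \<Rightarrow> ('v, 'l::linorder) ledge list \<Rightarrow> ('l list \<times> nat) option" where
  "greedy_and vs es =
     (let (s0, t0) = (init vs es ;; count_live ;; record_best) empty_store in
      map_option (\<lambda>(s, t). (best s, t0 + t))
        (loop_while (\<lambda>s. queue s \<noteq> rbt.Empty) greedy_round s0))"

end

(* The height of a red-black tree is logarithmic, so every tree operation costs at most a constant
   times h + 1, where h bounds the height of all trees whose keys are labels in use. The rounds are
   amortised: a live edge e holds credit for the h + O(1) steps of surviving a round, once for each
   of its labels that are still queued, since surviving the round of label k uses up k. It also holds
   O(h + 1) credit per label to pay for its own removal and for the queue updates this causes.
   Each queued label pays for being popped. The initial credit is O(p (h + 1) + |E|).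
   If there is only one label, log |L| = 0, but then p is at most |E|. *)
theory Submission
  imports Defs
begin

section \<open>Heights of red-black trees\<close>

primrec rbt_height :: "('a, 'b) rbt \<Rightarrow> nat" where
  "rbt_height rbt.Empty = 0"
| "rbt_height (rbt.Branch c l k v r) = Suc (max (rbt_height l) (rbt_height r))"

text \<open>No red node has a red child, so each red node on a path can be charged to the black node
  above it; only a red root has none, which gives the extra one.\<close>

lemma rbt_height_le_bheight:
  "\<lbrakk>inv1 t; inv2 t\<rbrakk> \<Longrightarrow> rbt_height t \<le> 2 * bheight t + (if color_of t = RBT_Impl.B then 0 else 1)"
  by (induction t) (auto split: if_splits color.splits)

text \<open>The two subtrees have equal black height, so each black level at least doubles the
  number of keys plus one.\<close>

lemma power_bheight_le: "inv2 t \<Longrightarrow> 2 ^ bheight t \<le> Suc (length (RBT_Impl.keys t))"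
  by (induction t) auto

text \<open>Rounding down keeps the bound a natural number, like the step counts, and makes it 0 for
  an empty tree; the latter matters for edges without labels.\<close>

definition height_bound :: "nat \<Rightarrow> nat" where
  "height_bound n = 2 * nat \<lfloor>log 2 (real (Suc n))\<rfloor>"

lemma height_bound_le_log: "real (height_bound n) \<le> 2 * log 2 (real (Suc n))"
proof -
  have "0 \<le> log 2 (real (Suc n))"
    by (simp add: zero_le_log_cancel_iff)
  then show ?thesis
    using of_int_floor_le[of "log 2 (real (Suc n))"] by (simp add: height_bound_def)
qed

text \<open>The root of a valid tree is black, so the extra one for red roots disappears. The size
  is measured by the domain of the lookup because the invariants below describe trees by their key
  sets.\<close>

lemma rbt_height_le_height_bound:
  fixes t :: "('a::linorder, 'b) rbt"
  assumes "is_rbt t" and "card (dom (rbt_lookup t)) \<le> n"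
  shows "rbt_height t \<le> height_bound n"
proof -
  have "length (RBT_Impl.keys t) = card (dom (rbt_lookup t))"
    using assms(1) by (simp add: rbt_lookup_keys distinct_card distinct_keys)
  then have "2 ^ bheight t \<le> Suc n"
    using power_bheight_le[of t] assms by (simp add: is_rbt_def)
  then have "real (bheight t) \<le> log 2 (real (Suc n))"
    by (rule le_log2_of_power)
  then have "bheight t \<le> nat \<lfloor>log 2 (real (Suc n))\<rfloor>"
    by (simp add: le_nat_floor)
  then show ?thesis
    using rbt_height_le_bheight[of t] assms(1) by (simp add: is_rbt_def height_bound_def)
qed

lemma T_lookup_le: "T_lookup t k \<le> Suc (rbt_height t)"
  by (induction t) auto

lemma T_insert_le: "T_insert k t \<le> rbt_height t + 2"
proof -
  have "T_ins k t \<le> Suc (rbt_height t)"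
    by (induction t) auto
  then show ?thesis
    by (simp add: T_insert_def)
qed

text \<open>Every recursive call descends one level in at least one of the two trees.\<close>

lemma T_combine_le: "T_combine a b \<le> Suc (rbt_height a + rbt_height b)"
  by (induction a b rule: T_combine.induct) auto

text \<open>Below the deleted node the two subtrees are joined, which may descend along both of
  them; hence the factor 2.\<close>

lemma T_delete_le: "T_delete k t \<le> 2 * rbt_height t + 2"
proof -
  have "T_del k t \<le> 2 * rbt_height t + 1"
  proof (induction t)
    case (Branch c l x y r)
    then show ?case
      using T_combine_le[of l r] by auto
  qed simp
  then show ?thesis
    by (simp add: T_delete_def)
qed

lemma T_max_key_le: "T_max_key t \<le> Suc (rbt_height t)"
  by (induction t) auto

lemma max_key_in_keys: "t \<noteq> rbt.Empty \<Longrightarrow> max_key t \<in> set (RBT_Impl.keys t)"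
  by (induction t rule: max_key.induct) auto


section \<open>Running times of programs\<close>

lemma fst_skip [simp]: "fst (skip s) = s"
  and snd_skip [simp]: "snd (skip s) = 0"
  and fst_step [simp]: "fst (step f s) = f s"
  and snd_step [simp]: "snd (step f s) = 1"
  and fst_seq [simp]: "fst ((p ;; q) s) = fst (q (fst (p s)))"
  and snd_seq [simp]: "snd ((p ;; q) s) = snd (p s) + snd (q (fst (p s)))"
  and fst_cond [simp]: "fst (cond g p q s) = (if fst (g s) then fst (p s) else fst (q s))"
  and snd_cond [simp]: "snd (cond g p q s) = snd (g s) + (if fst (g s) then snd (p s) else snd (q s))"
  and fst_test [simp]: "fst (test b s) = b s"
  and snd_test [simp]: "snd (test b s) = 1"
  by (simp_all add: skip_def step_def seq_def cond_def test_def split_beta Let_def)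

lemma reading_eq [simp]: "reading r f s = f (r s) s"
  by (simp add: reading_def)

lemma fst_for_each_Cons [simp]: "fst (for_each (x # xs) f s) = fst (for_each xs f (fst (f x s)))"
  and snd_for_each_Cons [simp]:
    "snd (for_each (x # xs) f s) = 1 + snd (f x s) + snd (for_each xs f (fst (f x s)))"
  by (simp_all add: split_beta Let_def)

declare for_each.simps(2) [simp del]

text \<open>The potential differences telescope. \<open>\<Psi>\<close> may also grow: what is left
  in it at the end is credit already charged here and available to later code. \<open>Suc\<close>
  and the leading 1 are the overhead of the loop itself.\<close>

lemma for_each_amortised:
  fixes \<Psi> c :: "_ \<Rightarrow> nat"
  assumes "P s"
    and "\<And>x s. x \<in> set xs \<Longrightarrow> P s \<Longrightarrow>
      P (fst (f x s)) \<and> snd (f x s) + \<Psi> (fst (f x s)) \<le> c x + \<Psi> s"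
  shows "P (fst (for_each xs f s)) \<and>
    snd (for_each xs f s) + \<Psi> (fst (for_each xs f s)) \<le> 1 + (\<Sum>x\<leftarrow>xs. Suc (c x)) + \<Psi> s"
  using assms
proof (induction xs arbitrary: s)
  case (Cons x xs)
  have x: "P (fst (f x s))" "snd (f x s) + \<Psi> (fst (f x s)) \<le> c x + \<Psi> s"
    using Cons.prems by auto
  show ?case
    using Cons.IH[OF x(1)] Cons.prems(2) x(2) by fastforce
qed simp

lemma for_each_bounded:
  fixes c :: "_ \<Rightarrow> nat"
  assumes "P s"
    and "\<And>x s. x \<in> set xs \<Longrightarrow> P s \<Longrightarrow> P (fst (f x s)) \<and> snd (f x s) \<le> c x"
  shows "P (fst (for_each xs f s)) \<and> snd (for_each xs f s) \<le> 1 + (\<Sum>x\<leftarrow>xs. Suc (c x))"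
  using for_each_amortised[where \<Psi> = "\<lambda>_. 0" and P = P and c = c, OF assms(1)] assms(2) by simp

text \<open>Each round, including its loop test, is paid by a drop of \<open>\<Phi>\<close>. As the
  drop is at least one, \<open>\<Phi>\<close> is a termination measure as well. The leading 1 is the
  first test.\<close>

lemma loop_while_amortised:
  fixes \<Phi> :: "'s \<Rightarrow> nat"
  assumes "P s"
    and body: "\<And>s. P s \<Longrightarrow> b s \<Longrightarrow> P (fst (p s)) \<and> snd (p s) + 1 + \<Phi> (fst (p s)) \<le> \<Phi> s"
  shows "\<exists>s' t. loop_while b p s = Some (s', t) \<and> t \<le> 1 + \<Phi> s"
proof -
  \<comment> \<open>The elapsed time is part of the loop state, so the induction has to allow an
    arbitrary starting value \<open>t\<close>.\<close>
  have "\<exists>s' t'. while_option (\<lambda>(s, t). b s) (\<lambda>(s, t). let (s1, t1) = p s in (s1, t + t1 + 1)) (s, t) =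
      Some (s', t') \<and> t' \<le> t + \<Phi> s" for t
    using \<open>P s\<close>
  proof (induction "\<Phi> s" arbitrary: s t rule: less_induct)
    case less
    show ?case
    proof (cases "b s")
      case True
      from body[OF less.prems True] have "P (fst (p s))" "\<Phi> (fst (p s)) < \<Phi> s"
        and "snd (p s) + 1 + \<Phi> (fst (p s)) \<le> \<Phi> s"
        by auto
      from less.hyps[OF this(2,1), of "t + snd (p s) + 1"] this(3) True show ?thesis
        by (subst while_option_unfold) (fastforce simp: split_beta Let_def)
    next
      case False
      then show ?thesis
        by (subst while_option_unfold) simp
    qed
  qed
  from this[of 1] show ?thesis
    by (simp add: loop_while_def)
qed


section \<open>The rounds of the algorithm\<close>

lemma snd_count_end: "snd (count_end x l s) \<le> 3"
  by (simp add: count_end_def)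

lemma snd_uncount_end: "snd (uncount_end x l s) \<le> 3"
  by (simp add: uncount_end_def)

lemma count_end_frame [simp]:
  "queue (fst (count_end x l s)) = queue s"
  "live (fst (count_end x l s)) = live s"
  "label_tree (fst (count_end x l s)) = label_tree s"
  by (simp_all add: count_end_def)

lemma uncount_end_frame [simp]:
  "queue (fst (uncount_end x l s)) = queue s"
  "dens (fst (uncount_end x l s)) = dens s"
  "live (fst (uncount_end x l s)) = live s"
  "current (fst (uncount_end x l s)) = current s"
  "changed (fst (uncount_end x l s)) = changed s"
  by (simp_all add: uncount_end_def)

text \<open>Every entry put on \<open>changed\<close> is stored together with a credit
  \<open>a\<close>, which later pays for updating the queue. The 8 steps per label are two single
  steps and two calls of \<open>uncount_end\<close>.\<close>

lemma remove_edge_amortised: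
  fixes s :: "('v, 'l) store"
  defines "P \<equiv> \<lambda>s' :: ('v, 'l) store. queue s' = queue s \<and> dens s' = dens s \<and> live s' = live s \<and>
    current s' = current s"
  shows "P (fst (remove_edge e s)) \<and>
    snd (remove_edge e s) + a * length (changed (fst (remove_edge e s)))
      \<le> 1 + (\<Sum>l\<leftarrow>labs e. Suc (8 + a)) + a * length (changed s)"
  unfolding remove_edge_def
proof (rule for_each_amortised[where P = P and \<Psi> = "\<lambda>s. a * length (changed s)"], goal_cases)
  case (2 l s')
  then show ?case
    using add_mono[OF snd_uncount_end snd_uncount_end] by (simp add: P_def)
qed (simp add: P_def)

lemma count_live_bounded:
  fixes s :: "('v, 'l) store"
  defines "P \<equiv> \<lambda>s' :: ('v, 'l) store. queue s' = queue s \<and> dens s' = dens s \<and> live s' = live s"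
  shows "P (fst (count_live s)) \<and> snd (count_live s) \<le> 2 + 6 * length (live s)"
proof -
  define s1 where "s1 = s\<lparr>stamp := stamp s + 1, count_edges := 0, count_verts := 0\<rparr>"
  define f :: "('v, 'l) ledge \<times> ('l, unit) rbt \<Rightarrow> ('v, 'l) store prog" where
    "f = (\<lambda>(e, t). step (\<lambda>s. s\<lparr>count_edges := count_edges s + 1\<rparr>) ;; visit (end1 e) ;; visit (end2 e))"
  \<comment> \<open>One step for the edge counter and at most two for visiting each end make
    5.\<close>
  have "P (fst (for_each (live s) f s1)) \<and>
      snd (for_each (live s) f s1) \<le> 1 + (\<Sum>x\<leftarrow>live s. Suc 5)"
    by (rule for_each_bounded[where P = P]) (auto simp: P_def s1_def f_def visit_def)
  moreover have "count_live s = (fst (for_each (live s) f s1), 1 + snd (for_each (live s) f s1))"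
    by (rule prod_eqI) (simp_all add: count_live_def f_def s1_def)
  ultimately show ?thesis
    by (simp add: sum_list_triv)
qed

section \<open>Costs of the queue operations\<close>

locale label_universe =
  fixes U :: "'l::linorder set"
  assumes finite_U: "finite U"
begin

text \<open>A single bound for the queue and all label trees, as the keys of each are indexed by
  labels in \<open>U\<close>.\<close>

definition h :: nat where
  "h = height_bound (card U)"

text \<open>The keys have to agree with the stored \<open>dens\<close> only: the true densities move
  away from it while edges are being removed, until the queue is updated.\<close>

definition queue_holds :: "('v, 'l) store \<Rightarrow> 'l set \<Rightarrow> bool" where
  "queue_holds s Q \<longleftrightarrow>
     Q \<subseteq> U \<and> is_rbt (queue s) \<and> dom (rbt_lookup (queue s)) = (\<lambda>l. (dens s l, l)) ` Q"

lemma queue_holds_cong: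
  "\<lbrakk>queue s' = queue s; dens s' = dens s\<rbrakk> \<Longrightarrow> queue_holds s' Q = queue_holds s Q"
  by (simp add: queue_holds_def)

lemma rbt_height_queue_le:
  assumes "queue_holds s Q"
  shows "rbt_height (queue s) \<le> h"
proof -
  have "card (dom (rbt_lookup (queue s))) \<le> card U"
    using assms finite_U unfolding queue_holds_def
    by (metis card_image_le card_mono finite_subset le_trans)
  then show ?thesis
    using assms rbt_height_le_height_bound unfolding queue_holds_def h_def by blast
qed

lemma fst_in_queue: "queue_holds s Q \<Longrightarrow> fst (in_queue l s) \<longleftrightarrow> l \<in> Q"
  by (auto simp: in_queue_def Let_def queue_holds_def domIff[symmetric])

lemma snd_in_queue: "queue_holds s Q \<Longrightarrow> snd (in_queue l s) \<le> h + 1"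
  using rbt_height_queue_le[of s Q] T_lookup_le[of "queue s"]
  by (fastforce simp: in_queue_def Let_def intro: le_trans)

lemma queue_holds_delete:
  "queue_holds s Q \<Longrightarrow> queue_holds (fst (queue_delete l s)) (Q - {l})"
  by (auto simp: queue_delete_def Let_def queue_holds_def rbt_lookup_rbt_delete)

lemma snd_queue_delete: "queue_holds s Q \<Longrightarrow> snd (queue_delete l s) \<le> 2 * h + 2"
  using rbt_height_queue_le[of s Q] T_delete_le[of "(dens s l, l)" "queue s"]
  by (simp add: queue_delete_def Let_def)

lemma queue_holds_insert:
  "\<lbrakk>queue_holds s Q; l \<in> U\<rbrakk> \<Longrightarrow> queue_holds (fst (queue_insert l s)) (insert l Q)"
  by (auto simp: queue_insert_def Let_def queue_holds_def rbt_lookup_rbt_insert)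

lemma snd_queue_insert: "queue_holds s Q \<Longrightarrow> snd (queue_insert l s) \<le> h + 2"
  using rbt_height_queue_le[of s Q] T_insert_le[of "(dens s l, l)" "queue s"]
  by (simp add: queue_insert_def Let_def)

text \<open>No key in the tree may become stale. Updating the queue overwrites the density of a
  label that has just been deleted; initialisation rewrites that of a queued label with the same
  value.\<close>

lemma queue_holds_dens_update:
  "\<lbrakk>queue_holds s Q; l \<in> Q \<Longrightarrow> d = dens s l\<rbrakk> \<Longrightarrow> queue_holds (s\<lparr>dens := (dens s)(l := d)\<rparr>) Q"
  unfolding queue_holds_def by (auto simp: image_iff)

lemma queue_frame [simp]:
  "live (fst (queue_delete l s)) = live s"
  "live (fst (queue_insert l s)) = live s"
  "live (fst (queue_pop_max s)) = live s"
  "dens (fst (queue_insert l s)) = dens s"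
  "num_edges (fst (queue_insert l s)) = num_edges s"
  "num_verts (fst (queue_insert l s)) = num_verts s"
  by (simp_all add: queue_delete_def queue_insert_def queue_pop_max_def Let_def)

lemma queue_pop_max_spec:
  assumes "queue_holds s Q" and "queue s \<noteq> rbt.Empty"
  defines "s' \<equiv> fst (queue_pop_max s)"
  shows "current s' \<in> Q" and "queue_holds s' (Q - {current s'})"
    and "snd (queue_pop_max s) \<le> 3 * h + 3"
proof -
  let ?k = "max_key (queue s)"
  have "?k \<in> dom (rbt_lookup (queue s))"
    using max_key_in_keys[OF assms(2)] assms(1) rbt_lookup_keys is_rbt_rbt_sorted
    unfolding queue_holds_def by metis
  then obtain l where l: "l \<in> Q" "?k = (dens s l, l)"
    using assms(1) by (auto simp: queue_holds_def)
  \<comment> \<open>The maximal key is the one under which \<open>l\<close> is filed, so popping it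
    has the effect of deleting \<open>l\<close> on the queue.\<close>
  have s': "s' = (fst (queue_delete l s))\<lparr>current := l\<rparr>"
    by (simp add: s'_def queue_pop_max_def queue_delete_def Let_def l(2))
  show "current s' \<in> Q"
    by (simp add: s' l(1))
  have "queue_holds s' Q' = queue_holds (fst (queue_delete l s)) Q'" for Q'
    by (rule queue_holds_cong) (simp_all add: s')
  then show "queue_holds s' (Q - {current s'})"
    using queue_holds_delete[OF assms(1), of l] by (simp add: s')
  show "snd (queue_pop_max s) \<le> 3 * h + 3"
    using T_max_key_le[of "queue s"] T_delete_le[of ?k "queue s"] rbt_height_queue_le[OF assms(1)]
    by (simp add: queue_pop_max_def Let_def)
qed

text \<open>A queued label is deleted and filed again, which leaves \<open>Q\<close> as it was. The
  cost per entry is that of a lookup, a deletion, one step and an insertion: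
  \<open>(h + 1) + (2 * h + 2) + 1 + (h + 2)\<close>. Repeated entries are paid separately.\<close>

lemma update_queue_bounded:
  assumes "queue_holds s Q"
  shows "(queue_holds (fst (update_queue s)) Q \<and> live (fst (update_queue s)) = live s) \<and>
    snd (update_queue s) \<le> 1 + (\<Sum>l\<leftarrow>changed s. Suc (4 * h + 6))"
  unfolding update_queue_def reading_eq
proof (rule for_each_bounded[where P = "\<lambda>s'. queue_holds s' Q \<and> live s' = live s"], goal_cases)
  case 1
  show ?case
    using assms by simp
next
  case (2 l s')
  then have s': "queue_holds s' Q" "live s' = live s"
    by auto
  show ?case
  proof (cases "l \<in> Q")
    case True
    define s1 where "s1 = fst (queue_delete l s')"
    define s2 where "s2 = s1\<lparr>dens := (dens s1)(l := label_density s1 l)\<rparr>"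
    have s1: "queue_holds s1 (Q - {l})"
      using queue_holds_delete[OF s'(1)] by (simp add: s1_def)
    then have s2: "queue_holds s2 (Q - {l})"
      unfolding s2_def by (rule queue_holds_dens_update) simp
    have "queue_holds (fst (queue_insert l s2)) Q"
      using queue_holds_insert[OF s2, of l] True s'(1) by (auto simp: queue_holds_def insert_absorb)
    moreover have "live s2 = live s"
      by (simp add: s1_def s2_def s'(2))
    ultimately show ?thesis
      using True fst_in_queue[OF s'(1)] snd_in_queue[OF s'(1), of l] snd_queue_delete[OF s'(1), of l]
        snd_queue_insert[OF s2, of l]
      by (simp flip: s1_def s2_def)
  next
    case False
    then show ?thesis
      using s' fst_in_queue[OF s'(1)] snd_in_queue[OF s'(1), of l] by simp
  qed
qed

section \<open>Credit of live edges and amortised cost of a round\<close>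

definition edge_ok :: "('v, 'l) ledge \<times> ('l, unit) rbt \<Rightarrow> bool" where
  "edge_ok = (\<lambda>(e, t). is_rbt t \<and> dom (rbt_lookup t) = set (labs e) \<and> set (labs e) \<subseteq> U)"

text \<open>The first two summands pay for the removal: the loop step, the failed lookup, and per
  label its removal (9) together with the credit \<open>4 * h + 7\<close> for a queue update.
  Surviving a round costs \<open>h + 9\<close>: lookup, loop step, keeping the edge, and 6 for
  counting it.\<close>

definition edge_potential :: "'l set \<Rightarrow> ('v, 'l) ledge \<times> ('l, unit) rbt \<Rightarrow> nat" where
  "edge_potential Q = (\<lambda>(e, t).
     3 + (5 * h + 16) * length (labs e) + (h + 9) * card (set (labs e) \<inter> Q))"

text \<open>The second bound charges the failed lookup of a removed edge to its labels. It also
  covers an edge without labels, whose tree is empty; so such an edge is removed in constant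
  time.\<close>

lemma edge_ok_height_le:
  assumes "edge_ok (e, t)"
  shows "rbt_height t \<le> h" and "rbt_height t \<le> h * length (labs e)"
proof -
  have "card (set (labs e)) \<le> card U"
    using assms finite_U by (auto simp: edge_ok_def intro: card_mono)
  then show "rbt_height t \<le> h"
    using assms by (auto simp: edge_ok_def h_def intro: rbt_height_le_height_bound)
  show "rbt_height t \<le> h * length (labs e)"
  proof (cases "labs e = []")
    case True
    then show ?thesis
      using assms rbt_height_le_height_bound[of t 0] by (simp add: edge_ok_def height_bound_def)
  next
    case False
    then have "1 \<le> length (labs e)"
      by (cases "labs e") simp_all
    from mult_le_mono[OF \<open>rbt_height t \<le> h\<close> this] show ?thesis
      by simp
  qed
qed

text \<open>The current label has left \<open>Q\<close>, so the credit of the edges shrinks from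
  \<open>insert (current s) Q\<close> to \<open>Q\<close>. The difference pays for the loop and
  leaves 6 per surviving edge for \<open>count_live\<close> and \<open>4 * h + 7\<close> per changed
  entry for \<open>update_queue\<close>.\<close>

lemma remove_edges_amortised:
  fixes s :: "('v, 'l) store"
  assumes ok: "\<forall>x \<in> set (live s). edge_ok x" and Q: "finite Q" "current s \<notin> Q"
  defines "s' \<equiv> fst (remove_edges_without_current s)"
  shows "queue s' = queue s \<and> dens s' = dens s \<and> (\<forall>x \<in> set (live s'). edge_ok x) \<and>
    snd (remove_edges_without_current s) +
      ((\<Sum>x\<leftarrow>live s'. 6 + edge_potential Q x) + (4 * h + 7) * length (changed s'))
    \<le> 2 + (\<Sum>x\<leftarrow>live s. edge_potential (insert (current s) Q) x)"
proof -
  define k where "k = current s"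
  define P where "P = (\<lambda>s1 :: ('v, 'l) store. queue s1 = queue s \<and> dens s1 = dens s \<and>
    current s1 = k \<and> (\<forall>x \<in> set (live s1). edge_ok x))"
  define \<Psi> where "\<Psi> = (\<lambda>s1 :: ('v, 'l) store.
    (\<Sum>x\<leftarrow>live s1. 6 + edge_potential Q x) + (4 * h + 7) * length (changed s1))"
  \<comment> \<open>The loop rule adds one per element. The potential is at least 3, so the
    subtraction does not truncate.\<close>
  define c where "c = (\<lambda>x :: ('v, 'l) ledge \<times> ('l, unit) rbt. edge_potential (insert k Q) x - 1)"
  define f :: "('v, 'l) ledge \<times> ('l, unit) rbt \<Rightarrow> ('v, 'l) store prog" where
    "f = (\<lambda>(e, t). cond (has_current t) (step (\<lambda>s. s\<lparr>live := (e, t) # live s\<rparr>)) (remove_edge e))"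
  define s0 where "s0 = s\<lparr>pending := live s, live := [], changed := []\<rparr>"
  have c: "Suc (c x) = edge_potential (insert k Q) x" for x
    by (simp add: c_def edge_potential_def split: prod.splits)
  have "P (fst (for_each (live s) f s0)) \<and>
    snd (for_each (live s) f s0) + \<Psi> (fst (for_each (live s) f s0))
      \<le> 1 + (\<Sum>x\<leftarrow>live s. Suc (c x)) + \<Psi> s0"
  proof (rule for_each_amortised[where P = P], goal_cases)
    case 1
    show ?case
      by (simp add: P_def s0_def k_def)
  next
    case (2 x s1)
    obtain e t where x: "x = (e, t)"
      by fastforce
    have et: "edge_ok (e, t)"
      using 2(1) ok x by auto
    have look: "fst (has_current t s1) \<longleftrightarrow> k \<in> set (labs e)"
      using et 2(2) by (auto simp: has_current_def P_def edge_ok_def domIff[symmetric])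
    have time: "snd (has_current t s1) \<le> Suc (rbt_height t)"
      by (simp add: has_current_def T_lookup_le)
    show ?case
    proof (cases "k \<in> set (labs e)")
      case True
      \<comment> \<open>Survival uses up the label \<open>k\<close>, which releases one portion
        \<open>h + 9\<close>.\<close>
      have "card (set (labs e) \<inter> insert k Q) = Suc (card (set (labs e) \<inter> Q))"
        using True Q by (simp add: k_def)
      then have "edge_potential (insert k Q) (e, t) = edge_potential Q (e, t) + (h + 9)"
        by (simp add: edge_potential_def)
      then have "c (e, t) = edge_potential Q (e, t) + (h + 8)"
        by (simp add: c_def)
      moreover have "snd (has_current t s1) \<le> h + 1"
        using time edge_ok_height_le(1)[OF et] by simp
      ultimately show ?thesis
        using True look 2(2) et by (simp add: f_def x P_def \<Psi>_def)
    next
      case False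
      define s2 where "s2 = fst (remove_edge e s1)"
      have r: "queue s2 = queue s1" "dens s2 = dens s1" "live s2 = live s1" "current s2 = current s1"
        and "snd (remove_edge e s1) + (4 * h + 7) * length (changed s2)
          \<le> 1 + (4 * h + 16) * length (labs e) + (4 * h + 7) * length (changed s1)"
        using remove_edge_amortised[of e s1 "4 * h + 7"]
        by (simp_all add: s2_def sum_list_triv algebra_simps)
      moreover have "2 + h * length (labs e) + (4 * h + 16) * length (labs e) \<le> c (e, t)"
        by (simp add: c_def edge_potential_def algebra_simps)
      ultimately have "snd (has_current t s1) + snd (remove_edge e s1) + \<Psi> s2 \<le> c (e, t) + \<Psi> s1"
        using time edge_ok_height_le(2)[OF et] by (simp add: \<Psi>_def)
      then show ?thesis
        using False look 2(2) r by (simp add: f_def x P_def s2_def)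
    qed
  qed
  moreover have "remove_edges_without_current s =
      (fst (for_each (live s) f s0), 1 + snd (for_each (live s) f s0))"
    by (rule prod_eqI) (simp_all add: remove_edges_without_current_def f_def s0_def)
  ultimately show ?thesis
    by (simp add: s'_def P_def \<Psi>_def s0_def c flip: k_def)
qed

text \<open>A queued label pays for its pop, at most \<open>3 * h + 3\<close>, and for the 9
  remaining steps of its round that depend on neither the edges nor the changed labels, including
  the loop test.\<close>

definition potential :: "('v, 'l) store \<Rightarrow> 'l set \<Rightarrow> nat" where
  "potential s Q = (3 * h + 12) * card Q + (\<Sum>x\<leftarrow>live s. edge_potential Q x)"

definition round_inv :: "('v, 'l) store \<Rightarrow> 'l set \<Rightarrow> bool" where
  "round_inv s Q \<longleftrightarrow> queue_holds s Q \<and> (\<forall>x \<in> set (live s). edge_ok x)"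

text \<open>The popped label pays for the pop and the constant overhead, the live edges for the
  scan; the credits left by the scan pay for updating the queue and counting. The labels in
  \<open>Q\<close> strictly decrease because the popped one is never put back.\<close>

lemma greedy_round_amortised:
  assumes inv: "round_inv s Q" and ne: "queue s \<noteq> rbt.Empty"
  shows "\<exists>Q' \<subset> Q. round_inv (fst (greedy_round s)) Q' \<and>
    snd (greedy_round s) + 1 + potential (fst (greedy_round s)) Q' \<le> potential s Q"
proof -
  have Q: "queue_holds s Q"
    using inv by (simp add: round_inv_def)
  have "finite Q"
    using Q finite_U finite_subset by (auto simp: queue_holds_def)
  define s1 where "s1 = fst (queue_pop_max s)"
  define k where "k = current s1"
  define Q' where "Q' = Q - {k}"
  define s2 where "s2 = s1\<lparr>chosen := current s1 # chosen s1\<rparr>"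
  define s3 where "s3 = fst (remove_edges_without_current s2)"
  define s4 where "s4 = fst (update_queue s3)"
  define s5 where "s5 = fst (count_live s4)"
  note defs = s1_def s2_def s3_def s4_def s5_def
  have pop: "k \<in> Q" "queue_holds s1 Q'" "snd (queue_pop_max s) \<le> 3 * h + 3"
    using queue_pop_max_spec[OF Q ne] by (simp_all add: s1_def k_def Q'_def)
  have kQ: "insert k Q' = Q" "finite Q'" "k \<notin> Q'"
    using pop \<open>finite Q\<close> by (auto simp: Q'_def)
  have "live s2 = live s" "current s2 = k"
    by (simp_all add: s2_def s1_def k_def)
  then have s3: "queue s3 = queue s2" "dens s3 = dens s2" "\<forall>x \<in> set (live s3). edge_ok x"
    and t3: "snd (remove_edges_without_current s2) +
      ((\<Sum>x\<leftarrow>live s3. 6 + edge_potential Q' x) + (4 * h + 7) * length (changed s3))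
      \<le> 2 + (\<Sum>x\<leftarrow>live s. edge_potential Q x)"
    using remove_edges_amortised[of s2 Q'] inv kQ by (simp_all add: s3_def round_inv_def)
  have "queue_holds s3 Q'"
    using pop(2) queue_holds_cong[of s3 s1] s3 by (simp add: s2_def)
  then have s4: "queue_holds s4 Q'" "live s4 = live s3"
    and t4: "snd (update_queue s3) \<le> 1 + (4 * h + 7) * length (changed s3)"
    using update_queue_bounded[of s3 Q'] by (simp_all add: s4_def sum_list_triv algebra_simps)
  have s5: "queue s5 = queue s4" "dens s5 = dens s4" "live s5 = live s3"
    and t5: "snd (count_live s4) \<le> 2 + 6 * length (live s3)"
    using count_live_bounded[of s4] s4 by (simp_all add: s5_def)
  define s6 where "s6 = fst (greedy_round s)"
  have s6: "queue s6 = queue s5" "dens s6 = dens s5" "live s6 = live s5"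
    by (simp_all add: s6_def greedy_round_def record_best_def flip: defs)
  have t6: "snd (greedy_round s) \<le> snd (queue_pop_max s) + 1 + snd (remove_edges_without_current s2)
      + snd (update_queue s3) + snd (count_live s4) + 2"
    by (simp add: greedy_round_def record_best_def flip: defs)
  have "card Q = Suc (card Q')"
    using kQ by (metis card_insert_disjoint)
  then have "snd (greedy_round s) + 1 + potential s6 Q' \<le> potential s Q"
    using pop(3) t3 t4 t5 t6 s5 s6
    by (simp add: potential_def sum_list_addf sum_list_triv algebra_simps)
  moreover have "round_inv s6 Q'"
    using s3 s4 s5 s6 queue_holds_cong[of s6 s4] by (simp add: round_inv_def)
  moreover have "Q' \<subset> Q"
    using pop(1) by (auto simp: Q'_def)
  ultimately show ?thesis
    unfolding s6_def by blast
qed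

section \<open>Initialisation and total running time\<close>

lemma edge_potential_mono: "Q \<subseteq> Q' \<Longrightarrow> edge_potential Q x \<le> edge_potential Q' x"
  by (auto simp: edge_potential_def intro!: mult_le_mono2 card_mono split: prod.splits)

lemma edge_potential_le:
  "edge_potential Q (e, t) \<le> 3 + (6 * h + 25) * length (labs e)"
proof -
  have "card (set (labs e) \<inter> Q) \<le> length (labs e)"
    by (meson card_length card_mono finite_set inf_le1 le_trans)
  then have "(h + 9) * card (set (labs e) \<inter> Q) \<le> (h + 9) * length (labs e)"
    by (rule mult_le_mono2)
  then show ?thesis
    by (simp add: edge_potential_def algebra_simps)
qed

lemma build_label_tree_bounded:
  fixes s :: "('v, 'l) store"
  assumes e: "set (labs e) \<subseteq> U" and s: "label_tree s = rbt.Empty"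
  defines "p \<equiv> for_each (labs e) (\<lambda>l.
         step (\<lambda>s. s\<lparr>num_edges := (num_edges s)(l := num_edges s l + 1)\<rparr>) ;;
         count_end (end1 e) l ;;
         count_end (end2 e) l ;;
         label_tree_insert l)"
  shows "queue (fst (p s)) = queue s \<and> live (fst (p s)) = live s \<and>
    edge_ok (e, label_tree (fst (p s))) \<and> snd (p s) \<le> 1 + (h + 10) * length (labs e)"
proof -
  define P where "P = (\<lambda>(A, s' :: ('v, 'l) store). A \<subseteq> U \<and> queue s' = queue s \<and> live s' = live s \<and>
    is_rbt (label_tree s') \<and> dom (rbt_lookup (label_tree s')) = A)"
  \<comment> \<open>The key set grows from pass to pass, which a fixed loop invariant cannot follow;
    hence an induction over the labels, with \<open>A\<close> the labels inserted before.\<close>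
  have "P (A \<union> set ls, fst (for_each ls f s')) \<and> snd (for_each ls f s') \<le> 1 + (h + 10) * length ls"
    if f: "f = (\<lambda>l.
         step (\<lambda>s. s\<lparr>num_edges := (num_edges s)(l := num_edges s l + 1)\<rparr>) ;;
         count_end (end1 e) l ;;
         count_end (end2 e) l ;;
         label_tree_insert l)" and "P (A, s')" "set ls \<subseteq> U" for A ls s' f
    using that(2,3)
  proof (induction ls arbitrary: A s')
    case (Cons l ls)
    have "card A \<le> card U"
      using Cons.prems(1) finite_U by (auto simp: P_def intro: card_mono)
    then have "rbt_height (label_tree s') \<le> h"
      using Cons.prems(1) rbt_height_le_height_bound by (fastforce simp: P_def h_def)
    then have T: "T_insert l (label_tree s') \<le> h + 2"
      using T_insert_le[of l "label_tree s'"] by simp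
    have t: "snd (f l s') \<le> h + 9"
      using add_mono[OF snd_count_end add_mono[OF snd_count_end T]]
      by (simp add: f label_tree_insert_def)
    have "P (insert l A, fst (f l s'))"
      using Cons.prems by (auto simp: f P_def label_tree_insert_def rbt_lookup_rbt_insert)
    from Cons.IH[OF this] Cons.prems(2) t show ?case
      by simp
  qed simp
  from this[OF refl, of "{}" s "labs e"] show ?thesis
    unfolding p_def[symmetric] using e s by (simp add: P_def edge_ok_def rbt_lookup_Empty)
qed

lemma init_queue_bounded:
  fixes s :: "('v, 'l) store"
  assumes es: "\<forall>e \<in> set es. set (labs e) \<subseteq> U" and s: "queue s = rbt.Empty"
  defines "p \<equiv> for_each es (\<lambda>e. for_each (labs e) (\<lambda>l.
       step (\<lambda>s. s\<lparr>dens := (dens s)(l := label_density s l)\<rparr>) ;;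
       queue_insert l))"
  shows "((\<exists>Q. queue_holds (fst (p s)) Q) \<and> live (fst (p s)) = live s) \<and>
    snd (p s) \<le> 1 + (\<Sum>e\<leftarrow>es. Suc (1 + (\<Sum>l\<leftarrow>labs e. Suc (h + 3))))"
proof -
  \<comment> \<open>A label on several edges is filed several times. The counters no longer change
    in this phase, so the stored density stays correct and the key is the same each time.\<close>
  define P where "P = (\<lambda>s' :: ('v, 'l) store. live s' = live s \<and>
    (\<exists>Q. queue_holds s' Q \<and> (\<forall>l \<in> Q. dens s' l = label_density s' l)))"
  have "P (fst (p s)) \<and> snd (p s) \<le> 1 + (\<Sum>e\<leftarrow>es. Suc (1 + (\<Sum>l\<leftarrow>labs e. Suc (h + 3))))"
    unfolding p_def
  proof (rule for_each_bounded[where P = P], goal_cases)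
    case 1
    have "queue_holds s {}"
      by (simp add: queue_holds_def s rbt_lookup_Empty)
    then show ?case
      unfolding P_def by blast
  next
    case (2 e s')
    show ?case
    proof (rule for_each_bounded[where P = P], goal_cases)
      case 1
      show ?case
        using 2 by simp
    next
      case (2 l s2)
      then obtain Q where Q: "queue_holds s2 Q" "\<forall>l \<in> Q. dens s2 l = label_density s2 l"
        unfolding P_def by blast
      have l: "l \<in> U"
        using 2 \<open>e \<in> set es\<close> es by auto
      define s3 where "s3 = s2\<lparr>dens := (dens s2)(l := label_density s2 l)\<rparr>"
      have s3: "queue_holds s3 Q"
        unfolding s3_def using Q by (intro queue_holds_dens_update) simp_all
      define s4 where "s4 = fst (queue_insert l s3)"
      have "queue_holds s4 (insert l Q)"
        unfolding s4_def using s3 l by (rule queue_holds_insert)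
      moreover have "\<forall>l' \<in> insert l Q. dens s4 l' = label_density s4 l'"
        using Q(2) by (auto simp: s4_def s3_def label_density_def)
      moreover have "live s4 = live s"
        using 2 by (simp add: s4_def s3_def P_def)
      ultimately have "P s4"
        unfolding P_def by blast
      then show ?case
        using snd_queue_insert[OF s3, of l] by (simp flip: s3_def s4_def)
    qed
  qed
  then show ?thesis
    unfolding P_def by blast
qed

text \<open>The credit given to the edges is counted as part of the cost: the potential for the
  rounds, and 6 per edge for the \<open>count_live\<close> that precedes them. As the queue is still
  empty when edges become live, the potential is taken over all of \<open>U\<close>.\<close>

lemma init_bounded:
  fixes vs :: "'v list" and es :: "('v, 'l) ledge list"
  assumes es: "\<forall>e \<in> set es. set (labs e) \<subseteq> U"
  defines "s \<equiv> fst (init vs es empty_store)"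
  shows "\<exists>Q. round_inv s Q \<and>
    snd (init vs es empty_store) + (\<Sum>x\<leftarrow>live s. 6 + edge_potential U x)
      \<le> 4 + 2 * length vs + 17 * length es + (8 * h + 44) * (\<Sum>e\<leftarrow>es. length (labs e))"
proof -
  define p1 :: "('v, 'l) store prog" where
    "p1 = for_each vs (\<lambda>v. step (\<lambda>s. s\<lparr>mark := (mark s)(v := 0)\<rparr>))"
  define p2 :: "('v, 'l) store prog" where
    "p2 = for_each es (\<lambda>e. for_each (labs e) (\<lambda>l.
       step (\<lambda>s. s\<lparr>num_edges := (num_edges s)(l := 0)\<rparr>) ;;
       step (\<lambda>s. s\<lparr>num_verts := (num_verts s)(l := 0)\<rparr>) ;;
       step (\<lambda>s. s\<lparr>deg := (deg s)(end1 e := (deg s (end1 e))(l := 0))\<rparr>) ;;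
       step (\<lambda>s. s\<lparr>deg := (deg s)(end2 e := (deg s (end2 e))(l := 0))\<rparr>)))"
  define p3 :: "('v, 'l) store prog" where
    "p3 = for_each es (\<lambda>e.
       step (\<lambda>s. s\<lparr>label_tree := rbt.Empty\<rparr>) ;;
       for_each (labs e) (\<lambda>l.
         step (\<lambda>s. s\<lparr>num_edges := (num_edges s)(l := num_edges s l + 1)\<rparr>) ;;
         count_end (end1 e) l ;;
         count_end (end2 e) l ;;
         label_tree_insert l) ;;
       step (\<lambda>s. s\<lparr>live := (e, label_tree s) # live s\<rparr>))"
  define p4 :: "('v, 'l) store prog" where
    "p4 = for_each es (\<lambda>e. for_each (labs e) (\<lambda>l.
       step (\<lambda>s. s\<lparr>dens := (dens s)(l := label_density s l)\<rparr>) ;;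
       queue_insert l))"
  have init: "init vs es = p1 ;; p2 ;; p3 ;; p4"
    by (simp add: init_def p1_def p2_def p3_def p4_def)
  define fresh where "fresh = (\<lambda>s :: ('v, 'l) store. queue s = rbt.Empty \<and> live s = [])"
  define s1 where "s1 = fst (p1 empty_store)"
  define s2 where "s2 = fst (p2 s1)"
  define s3 where "s3 = fst (p3 s2)"
  have s1: "fresh s1 \<and> snd (p1 empty_store) \<le> 1 + (\<Sum>v\<leftarrow>vs. Suc 1)"
    unfolding s1_def p1_def
    by (intro for_each_bounded[where P = fresh]) (simp_all add: fresh_def empty_store_def)
  have s2: "fresh s2 \<and> snd (p2 s1) \<le> 1 + (\<Sum>e\<leftarrow>es. Suc (1 + (\<Sum>l\<leftarrow>labs e. Suc 4)))"
    unfolding s2_def p2_def using s1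
    by (intro for_each_bounded[where P = fresh]) (simp_all add: fresh_def)
  define P where "P = (\<lambda>s :: ('v, 'l) store. queue s = rbt.Empty \<and> (\<forall>x \<in> set (live s). edge_ok x))"
  define \<Psi> where "\<Psi> = (\<lambda>s :: ('v, 'l) store. \<Sum>x\<leftarrow>live s. 6 + edge_potential U x)"
  have s3: "P s3 \<and> snd (p3 s2) + \<Psi> s3
      \<le> 1 + (\<Sum>e\<leftarrow>es. Suc (12 + (7 * h + 35) * length (labs e))) + \<Psi> s2"
    unfolding s3_def p3_def
  proof (rule for_each_amortised[where P = P], goal_cases)
    case 1
    show ?case
      using s2 by (simp add: P_def fresh_def)
  next
    case (2 e s)
    have "set (labs e) \<subseteq> U"
      using 2 es by blast
    note build_label_tree = build_label_tree_bounded[OF this, of "s\<lparr>label_tree := rbt.Empty\<rparr>"]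
    obtain s' n where build: "for_each (labs e) (\<lambda>l.
         step (\<lambda>s. s\<lparr>num_edges := (num_edges s)(l := num_edges s l + 1)\<rparr>) ;;
         count_end (end1 e) l ;;
         count_end (end2 e) l ;;
         label_tree_insert l) (s\<lparr>label_tree := rbt.Empty\<rparr>) = (s', n)"
      by (rule prod.exhaust)
    have s': "queue s' = queue s" "live s' = live s" "edge_ok (e, label_tree s')"
        "n \<le> 1 + (h + 10) * length (labs e)"
      using build_label_tree unfolding build by simp_all
    \<comment> \<open>Besides the label loop, an edge costs two steps and receives its credit; the
      surplus 1 on both sides is the loop step.\<close>
    have "3 + n + edge_potential U (e, label_tree s') + 6 \<le> 12 + (7 * h + 35) * length (labs e) + 1"
      using edge_potential_le[of U e "label_tree s'"] s'(4) by (simp add: algebra_simps)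
    then show ?case
      using 2(2) s' unfolding fst_seq snd_seq fst_step snd_step build by (simp add: P_def \<Psi>_def)
  qed
  have s4: "\<exists>Q. queue_holds s Q" "live s = live s3"
      "snd (p4 s3) \<le> 1 + (\<Sum>e\<leftarrow>es. Suc (1 + (\<Sum>l\<leftarrow>labs e. Suc (h + 3))))"
    using init_queue_bounded[OF es, of s3] s3
    by (simp_all add: s_def init p4_def P_def flip: s1_def s2_def s3_def)
  obtain Q where "queue_holds s Q"
    using s4 by auto
  then have inv: "round_inv s Q"
    using s3 s4(2) by (auto simp: round_inv_def P_def)
  have I: "(\<Sum>x\<leftarrow>xs. Suc c) = Suc c * length xs" for c and xs :: "'a list"
    by (simp add: sum_list_triv)
  have S: "(\<Sum>e\<leftarrow>es. Suc (b + c * length (labs e))) =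
      Suc b * length es + c * (\<Sum>e\<leftarrow>es. length (labs e))" for b c
    by (induction es) (simp_all add: algebra_simps)
  moreover have "snd (init vs es empty_store) =
      snd (p1 empty_store) + snd (p2 s1) + snd (p3 s2) + snd (p4 s3)"
    by (simp add: init flip: s1_def s2_def s3_def)
  moreover have "\<Psi> s2 = 0"
    using s2 by (simp add: \<Psi>_def fresh_def)
  \<comment> \<open>The three loops over the edges contribute 2, 13 and 2 per edge, and 5,
    \<open>7 * h + 35\<close> and \<open>h + 4\<close> per label of an edge.\<close>
  ultimately have "snd (init vs es empty_store) + \<Psi> s3
      \<le> 4 + 2 * length vs + 17 * length es + (8 * h + 44) * (\<Sum>e\<leftarrow>es. length (labs e))"
    using s1 s2 s3 s4(3) unfolding I S by (simp add: algebra_simps)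
  with inv show ?thesis
    unfolding \<Psi>_def s4(2) by blast
qed

lemma greedy_and_bounded:
  fixes es :: "('v, 'l) ledge list"
  assumes es: "\<forall>e \<in> set es. set (labs e) \<subseteq> U"
  shows "\<exists>A t. greedy_and vs es = Some (A, t) \<and>
    t \<le> 8 + 2 * length vs + 17 * length es + (8 * h + 44) * (\<Sum>e\<leftarrow>es. length (labs e))
      + (3 * h + 12) * card U"
proof -
  define s0 where "s0 = fst (init vs es empty_store)"
  obtain Q where Q: "round_inv s0 Q"
    and t0: "snd (init vs es empty_store) + (\<Sum>x\<leftarrow>live s0. 6 + edge_potential U x)
      \<le> 4 + 2 * length vs + 17 * length es + (8 * h + 44) * (\<Sum>e\<leftarrow>es. length (labs e))"
    using init_bounded[OF es, of vs] by (auto simp: s0_def)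
  define s1 where "s1 = fst ((init vs es ;; count_live ;; record_best) empty_store)"
  define t1 where "t1 = snd ((init vs es ;; count_live ;; record_best) empty_store)"
  have s1: "queue s1 = queue s0" "dens s1 = dens s0" "live s1 = live s0"
    and t1: "t1 \<le> snd (init vs es empty_store) + (2 + 6 * length (live s0)) + 1"
    using count_live_bounded[of s0]
    by (simp_all add: s1_def t1_def record_best_def flip: s0_def)
  have Q1: "round_inv s1 Q"
    using Q s1 queue_holds_cong[of s1 s0] by (simp add: round_inv_def)
  then have QU: "Q \<subseteq> U"
    by (simp add: round_inv_def queue_holds_def)
  text \<open>The set of queued labels is a function of the tree, so the potential depends on the store only.\<close>
  define labels_of :: "('v, 'l) store \<Rightarrow> 'l set" where
    "labels_of = (\<lambda>s. snd ` dom (rbt_lookup (queue s)))"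
  have labels_of: "labels_of s = Q'" if "round_inv s Q'" for s :: "('v, 'l) store" and Q'
    using that by (simp add: labels_of_def round_inv_def queue_holds_def image_image)
  have "\<exists>s' t. loop_while (\<lambda>s. queue s \<noteq> rbt.Empty) greedy_round s1 = Some (s', t) \<and>
    t \<le> 1 + potential s1 (labels_of s1)"
  proof (rule loop_while_amortised[where P = "\<lambda>s. \<exists>Q. round_inv s Q"])
    show "\<exists>Q. round_inv s1 Q"
      using Q1 ..
  next
    fix s :: "('v, 'l) store"
    assume "\<exists>Q. round_inv s Q" and "queue s \<noteq> rbt.Empty"
    then show "(\<exists>Q. round_inv (fst (greedy_round s)) Q) \<and>
      snd (greedy_round s) + 1 + potential (fst (greedy_round s)) (labels_of (fst (greedy_round s)))
        \<le> potential s (labels_of s)"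
      using greedy_round_amortised labels_of by metis
  qed
  then obtain s' t where t: "loop_while (\<lambda>s. queue s \<noteq> rbt.Empty) greedy_round s1 = Some (s', t)"
      "t \<le> 1 + potential s1 Q"
    using labels_of[OF Q1] by auto
  have "card Q \<le> card U"
    using QU finite_U by (rule card_mono[rotated])
  then have "(3 * h + 12) * card Q \<le> (3 * h + 12) * card U"
    by (rule mult_le_mono2)
  \<comment> \<open>Initialisation has provided credit for all of \<open>U\<close>, which covers the
    labels actually queued.\<close>
  moreover have "(\<Sum>x\<leftarrow>live s0. edge_potential Q x) \<le> (\<Sum>x\<leftarrow>live s0. edge_potential U x)"
    by (intro sum_list_mono edge_potential_mono QU)
  moreover have "(\<Sum>x\<leftarrow>live s0. 6 + edge_potential U x)
      = 6 * length (live s0) + (\<Sum>x\<leftarrow>live s0. edge_potential U x)"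
    by (simp add: sum_list_addf sum_list_triv)
  ultimately have "t1 + t \<le> 8 + 2 * length vs + 17 * length es
      + (8 * h + 44) * (\<Sum>e\<leftarrow>es. length (labs e)) + (3 * h + 12) * card U"
    using t(2) t1 t0 unfolding potential_def s1 by linarith
  moreover have "(init vs es ;; count_live ;; record_best) empty_store = (s1, t1)"
    unfolding s1_def t1_def by (rule prod.collapse[symmetric])
  then have "greedy_and vs es = Some (best s', t1 + t)"
    by (simp add: greedy_and_def t(1))
  ultimately show ?thesis
    by blast
qed

end

section \<open>From the input lists to the size of the graph\<close>

lemma card_edge_label_pairs:
  assumes "edge_labeled_graph G" and "represents vs es G"
  shows "card (edge_label_pairs G) = (\<Sum>e\<leftarrow>es. length (labs e))"
proof -
  have es: "distinct es" "inj_on ends (set es)" "ends ` set es = edges G"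
    and lab: "\<And>e. e \<in> set es \<Longrightarrow> lab G (ends e) = set (labs e) \<and> distinct (labs e)"
    using assms(2) by (auto simp: represents_def distinct_map)
  have "edge_label_pairs G = Sigma (edges G) (lab G)"
    by (auto simp: edge_label_pairs_def)
  moreover have "\<forall>e \<in> edges G. finite (lab G e)"
    using assms(1) finite_subset by (fastforce simp: edge_labeled_graph_def)
  moreover have "finite (edges G)"
    using es(3) by (metis finite_imageI finite_set)
  ultimately have "card (edge_label_pairs G) = (\<Sum>e\<in>ends ` set es. card (lab G e))"
    by (simp add: es(3))
  \<comment> \<open>Distinct list entries have distinct end sets, and no label is repeated within an
    entry.\<close>
  also have "\<dots> = (\<Sum>e\<in>set es. length (labs e))"
    using es(2) lab by (simp add: sum.reindex distinct_card)
  also have "\<dots> = (\<Sum>e\<leftarrow>es. length (labs e))"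
    using es(1) by (simp add: sum_list_distinct_conv_sum_set)
  finally show ?thesis .
qed

theorem theorem2:
  shows "\<exists>C::real. \<forall>(G :: ('v, 'l::linorder) lgraph) vs es.
    edge_labeled_graph G \<longrightarrow> represents vs es G \<longrightarrow>
    (\<exists>A t. greedy_and vs es = Some (A, t) \<and>
       real t \<le> C * (real (card (edge_label_pairs G)) * log 2 (real (card (labels G)))
                     + real (card (verts G)) + real (card (edges G))))"
proof (intro exI[of _ 200] allI impI)
  fix G :: "('v, 'l) lgraph" and vs es
  assume G: "edge_labeled_graph G" and rep: "represents vs es G"
  define p where "p = (\<Sum>e\<leftarrow>es. length (labs e))"
  \<comment> \<open>Only labels that occur on edges are taken: their number is at most
    \<open>p\<close>, whereas \<open>labels G\<close> may be larger than every term of the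
    bound.\<close>
  define U where "U = set (concat (map labs es))"
  interpret label_universe U
    by standard (simp add: U_def)
  have vs: "distinct vs" "set vs = verts G"
    and es: "distinct (map ends es)" "ends ` set es = edges G"
    and labs: "\<And>e. e \<in> set es \<Longrightarrow> distinct (labs e) \<and> set (labs e) = lab G (ends e)"
    using rep unfolding represents_def by blast+
  have V: "length vs = card (verts G)"
    using distinct_card[OF vs(1)] vs(2) by simp
  \<comment> \<open>A vertex exists to absorb the additive constant 8.\<close>
  have V1: "card (verts G) \<ge> 1"
    using G by (simp add: edge_labeled_graph_def Suc_le_eq card_gt_0_iff)
  have E: "length es = card (edges G)"
    using distinct_card[OF es(1)] es(2) by simp
  have L: "finite (labels G)"
    using G by (simp add: edge_labeled_graph_def)
  have "lab G e \<subseteq> labels G" if "e \<in> edges G" for e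
    using G that by (simp add: edge_labeled_graph_def)
  then have UL: "U \<subseteq> labels G"
    using es(2) labs by (fastforce simp: U_def)
  have Up: "card U \<le> p"
    using card_length[of "concat (map labs es)"]
    by (simp add: U_def p_def length_concat o_def)
  have "\<forall>e \<in> set es. set (labs e) \<subseteq> U"
    by (auto simp: U_def)
  from greedy_and_bounded[OF this, of vs] obtain A t where A: "greedy_and vs es = Some (A, t)"
    and "t \<le> 8 + 2 * length vs + 17 * length es + (8 * h + 44) * p + (3 * h + 12) * card U"
    by (auto simp: p_def)
  moreover have "(3 * h + 12) * card U \<le> (3 * h + 12) * p"
    using Up by (rule mult_le_mono2)
  ultimately have "t \<le> 10 * card (verts G) + 17 * card (edges G) + 11 * (h * p) + 56 * p"
    using V V1 E by (simp add: algebra_simps)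
  then have t: "real t \<le> 10 * real (card (verts G)) + 17 * real (card (edges G))
      + 11 * (real h * real p) + 56 * real p"
    by (metis (no_types) of_nat_add of_nat_le_iff of_nat_mult of_nat_numeral)
  define x where "x = log 2 (real (card (labels G)))"
  \<comment> \<open>The extra edge term is for graphs with at most one label, where the logarithm
    vanishes. With the 17 from above, the coefficient of the edges stays below 200.\<close>
  have "56 * real p + 11 * (real h * real p) \<le> 200 * (real p * x) + 100 * real (card (edges G))"
  proof (cases "card (labels G) \<le> 1")
    case True
    have "length (labs e) \<le> 1" if "e \<in> set es" for e
    proof -
      have "length (labs e) = card (set (labs e))"
        using labs[OF that] distinct_card by metis
      moreover have "set (labs e) \<subseteq> U"
        using that by (auto simp: U_def)
      ultimately have "length (labs e) \<le> card (labels G)"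
        using card_mono[OF L] UL by simp
      then show ?thesis
        using True by simp
    qed
    then have "p \<le> (\<Sum>e\<leftarrow>es. 1)"
      unfolding p_def by (intro sum_list_mono)
    then have p: "p \<le> card (edges G)"
      by (simp add: sum_list_triv E)
    have "card U \<le> 1"
      using True card_mono[OF L UL] by simp
    then have "log 2 (real (Suc (card U))) \<le> log 2 2"
      by (intro log_mono) auto
    then have "real h \<le> 2 * log 2 2"
      using height_bound_le_log[of "card U"] unfolding h_def by linarith
    then have "h \<le> 2"
      by simp
    then have "h * p \<le> 2 * p"
      by simp
    then have "real h * real p \<le> 2 * real p"
      by (metis of_nat_le_iff of_nat_mult of_nat_numeral)
    \<comment> \<open>Besides \<open>log 2 1 = 0\<close> this uses the convention
      \<open>log 2 0 = 0\<close> for an empty label set.\<close>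
    moreover have "x = 0"
      using True by (cases "card (labels G)") (auto simp: x_def log_def)
    ultimately show ?thesis
      using p by simp
  next
    case False
    then have x: "x \<ge> 1"
      by (simp add: x_def)
    \<comment> \<open>Doubling absorbs the successor at the price of one in the logarithm. Since
      \<open>x\<close> is at least 1, this yields
      \<open>h \<le> 2 * (1 + x) \<le> 4 * x\<close>.\<close>
    have "Suc (card U) \<le> 2 * card (labels G)"
      using False card_mono[OF L UL] by simp
    then have "log 2 (real (Suc (card U))) \<le> log 2 (2 * real (card (labels G)))"
      by (intro log_mono) auto
    also have "\<dots> = 1 + x"
      using False by (simp add: log_mult x_def)
    finally have "real h \<le> 2 * (1 + x)"
      using height_bound_le_log[of "card U"] by (simp add: h_def)
    then have "real h * real p \<le> 4 * x * real p"
      using x by (intro mult_right_mono) auto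
    moreover have "real p * 1 \<le> real p * x"
      using x by (intro mult_left_mono) auto
    ultimately show ?thesis
      by (simp add: algebra_simps)
  qed
  then have "real t \<le> 200 * (real (card (edge_label_pairs G)) * x
      + real (card (verts G)) + real (card (edges G)))"
    using t card_edge_label_pairs[OF G rep] by (simp add: p_def)
  with A show "\<exists>A t. greedy_and vs es = Some (A, t) \<and>
       real t \<le> 200 * (real (card (edge_label_pairs G)) * log 2 (real (card (labels G)))
                     + real (card (verts G)) + real (card (edges G)))"
    unfolding x_def by blast
qed

end
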